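(* Let $(M,\mathcal{C},\mathcal{C}^* )$ be a Farkas property oriented matroid on $E$ and let $N=M/F\setminus G$ be a minor of $M$ (with $F,G\subseteq E$ disjoint). Then $(N,\mathcal{S}^{\mathcal{C}}(N),\mathcal{S}^{\mathcal{C}^*}(N))$ is a Farkas property oriented matroid. Thus the class of FP-oriented matroids is closed under taking minors.
   Context: Matroids are in the sense of Bruhn, Diestel, Kriesell, Pendavingh and Wollan (possibly infinite ground set); cocircuits are circuits of the dual. A signed subset $X$ of $E$ is a support $\underline{X}\subseteq E$ with a partition $(X^+,X^-)$; $-X$ swaps the parts; $X|_A$ has parts $X^\pm\cap A$; $X$ is positive if $\underline{X}=X^+\neq\emptyset$. For $A\subseteq E$ the reorientation ${}_{-A}X$ has ${}_{-A}X^+=(X^+\setminus A)\cup(X^-\cap A)$, ${}_{-A}X^-=(X^-\setminus A)\cup(X^+\cap A)$, and ${}_{-A}\mathcal{S}=\{{}_{-A}X: X\in\mathcal{S}\}$. A circuit signature of $M$ is a set of signed subsets consisting of exactly two opposite signed subsets supported by each circuit of $M$; a cocircuit signature is a circuit signature of $M^*$. A pair $\mathcal{S},\mathcal{T}$ of sets of signed subsets of a set $E'$ has the Farkas property (FP) if for every $e\in E'$ exactly one of the following holds: there is a positive $X\in\mathcal{S}$ with $e\in\underline{X}$, or there is a positive $Y\in\mathcal{T}$ with $e\in\underline{Y}$. For a circuit signature $\mathcal{C}$ and cocircuit signature $\mathcal{C}^*$ of $M$ and a minor $N=M/F\setminus G$ with ground set $E(N)=E\setminus(F\cup G)$, put $\mathcal{S}^{\mathcal{C}}(N)=\{C|_{E(N)}: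 C\in\mathcal{C},\ \underline{C|_{E(N)}}\text{ is a circuit of }N,\ \underline{C}\subseteq E(N)\cup F\}$ and $\mathcal{S}^{\mathcal{C}^*}(N)=\{U|_{E(N)}: U\in\mathcal{C}^*,\ \underline{U|_{E(N)}}\text{ is a cocircuit of }N,\ \underline{U}\subseteq E(N)\cup G\}$. The triple $(M,\mathcal{C},\mathcal{C}^* )$ is a Farkas property oriented (FP-oriented) matroid if for every minor $N$ of $M$ and every $A\subseteq E(N)$ the pair ${}_{-A}\mathcal{S}^{\mathcal{C}}(N), {}_{-A}\mathcal{S}^{\mathcal{C}^*}(N)$ has the Farkas property. *)

theory Defs
  imports Main
begin

text \<open>Infinite matroids in the sense of Bruhn, Diestel, Kriesell, Pendavingh and Wollan. The type
  only carries the data (ground set, independent sets); the axioms are the predicate \<open>matroid\<close>.\<close>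

datatype 'a set_system = Set_System (ground: "'a set") (indep: "'a set set")

definition base :: "'a set_system \<Rightarrow> 'a set \<Rightarrow> bool" where
  "base M B \<longleftrightarrow> B \<in> indep M \<and> (\<forall>I\<in>indep M. B \<subseteq> I \<longrightarrow> I = B)"

text \<open>The four clauses after \<open>indep M \<subseteq> Pow (ground M)\<close> are the axioms (I1), (I2), (I3), (IM).\<close>

definition matroid :: "'a set_system \<Rightarrow> bool" where
  "matroid M \<longleftrightarrow>
     indep M \<subseteq> Pow (ground M) \<and>
     {} \<in> indep M \<and>
     (\<forall>I J. J \<in> indep M \<longrightarrow> I \<subseteq> J \<longrightarrow> I \<in> indep M) \<and>
     (\<forall>I B. I \<in> indep M \<longrightarrow> \<not> base M I \<longrightarrow> base M B \<longrightarrow>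
        (\<exists>x\<in>B - I. insert x I \<in> indep M)) \<and>
     (\<forall>I X. I \<in> indep M \<longrightarrow> I \<subseteq> X \<longrightarrow> X \<subseteq> ground M \<longrightarrow>
        (\<exists>J\<in>indep M. I \<subseteq> J \<and> J \<subseteq> X \<and>
           (\<forall>K\<in>indep M. J \<subseteq> K \<and> K \<subseteq> X \<longrightarrow> K = J)))"

definition circuit :: "'a set_system \<Rightarrow> 'a set \<Rightarrow> bool" where
  "circuit M D \<longleftrightarrow> D \<subseteq> ground M \<and> D \<notin> indep M \<and> (\<forall>I. I \<subset> D \<longrightarrow> I \<in> indep M)"

definition dual :: "'a set_system \<Rightarrow> 'a set_system" where
  "dual M = Set_System (ground M) {I. \<exists>B. base M B \<and> I \<subseteq> ground M - B}"

definition cocircuit :: "'a set_system \<Rightarrow> 'a set \<Rightarrow> bool" where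
  "cocircuit M D \<longleftrightarrow> circuit (dual M) D"

definition delete :: "'a set_system \<Rightarrow> 'a set \<Rightarrow> 'a set_system" where
  "delete M G = Set_System (ground M - G) {I \<in> indep M. I \<inter> G = {}}"

definition contract :: "'a set_system \<Rightarrow> 'a set \<Rightarrow> 'a set_system" where
  "contract M F = dual (delete (dual M) F)"

definition minor :: "'a set_system \<Rightarrow> 'a set \<Rightarrow> 'a set \<Rightarrow> 'a set_system" where
  "minor M F G = delete (contract M F) G"

lemma ground_minor: "ground (minor M F G) = ground M - (F \<union> G)"
  by (auto simp: minor_def delete_def contract_def dual_def)


text \<open>Signed subsets are pairs of sets; \<open>signed_subset\<close> adds that the two parts are disjoint.\<close>

datatype 'a signed = Signed (pos: "'a set") (neg: "'a set")

definition supp :: "'a signed \<Rightarrow> 'a set" where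
  "supp X = pos X \<union> neg X"

definition signed_subset :: "'a set \<Rightarrow> 'a signed \<Rightarrow> bool" where
  "signed_subset E X \<longleftrightarrow> supp X \<subseteq> E \<and> pos X \<inter> neg X = {}"

definition opposite :: "'a signed \<Rightarrow> 'a signed" where
  "opposite X = Signed (neg X) (pos X)"

definition restrict_signed :: "'a signed \<Rightarrow> 'a set \<Rightarrow> 'a signed" where
  "restrict_signed X A = Signed (pos X \<inter> A) (neg X \<inter> A)"

definition positive :: "'a signed \<Rightarrow> bool" where
  "positive X \<longleftrightarrow> supp X = pos X \<and> pos X \<noteq> {}"

definition reorient :: "'a set \<Rightarrow> 'a signed \<Rightarrow> 'a signed" where
  "reorient A X = Signed ((pos X - A) \<union> (neg X \<inter> A)) ((neg X - A) \<union> (pos X \<inter> A))"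

definition circuit_signature :: "'a set_system \<Rightarrow> 'a signed set \<Rightarrow> bool" where
  "circuit_signature M \<C> \<longleftrightarrow>
     (\<forall>X\<in>\<C>. signed_subset (ground M) X \<and> circuit M (supp X)) \<and>
     (\<forall>D. circuit M D \<longrightarrow>
        (\<exists>X. X \<noteq> opposite X \<and> {Y \<in> \<C>. supp Y = D} = {X, opposite X}))"

definition cocircuit_signature :: "'a set_system \<Rightarrow> 'a signed set \<Rightarrow> bool" where
  "cocircuit_signature M \<D> \<longleftrightarrow> circuit_signature (dual M) \<D>"

definition farkas :: "'a set \<Rightarrow> 'a signed set \<Rightarrow> 'a signed set \<Rightarrow> bool" where
  "farkas E \<S> \<T> \<longleftrightarrow>
     (\<forall>e\<in>E. (\<exists>X\<in>\<S>. positive X \<and> e \<in> supp X) \<noteq> (\<exists>Y\<in>\<T>. positive Y \<and> e \<in> supp Y))"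

text \<open>The induced signatures depend on the presentation \<open>M/F\G\<close> and not only on the resulting
  matroid, hence the arguments \<open>F\<close> and \<open>G\<close>.\<close>

definition minor_circuit_sig ::
  "'a set_system \<Rightarrow> 'a signed set \<Rightarrow> 'a set \<Rightarrow> 'a set \<Rightarrow> 'a signed set" where
  "minor_circuit_sig M \<C> F G =
     (let N = minor M F G in
       {restrict_signed X (ground N) | X.
          X \<in> \<C> \<and> circuit N (supp (restrict_signed X (ground N))) \<and> supp X \<subseteq> ground N \<union> F})"

definition minor_cocircuit_sig ::
  "'a set_system \<Rightarrow> 'a signed set \<Rightarrow> 'a set \<Rightarrow> 'a set \<Rightarrow> 'a signed set" where
  "minor_cocircuit_sig M \<D> F G =
     (let N = minor M F G in
       {restrict_signed U (ground N) | U.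
          U \<in> \<D> \<and> cocircuit N (supp (restrict_signed U (ground N))) \<and> supp U \<subseteq> ground N \<union> G})"

definition FP_oriented :: "'a set_system \<Rightarrow> 'a signed set \<Rightarrow> 'a signed set \<Rightarrow> bool" where
  "FP_oriented M \<C> \<D> \<longleftrightarrow>
     matroid M \<and> circuit_signature M \<C> \<and> cocircuit_signature M \<D> \<and>
     (\<forall>F G A. F \<subseteq> ground M \<longrightarrow> G \<subseteq> ground M \<longrightarrow> F \<inter> G = {} \<longrightarrow> A \<subseteq> ground (minor M F G) \<longrightarrow>
        farkas (ground (minor M F G))
          (reorient A ` minor_circuit_sig M \<C> F G)
          (reorient A ` minor_cocircuit_sig M \<D> F G))"

definition minor_closed ::
  "('a set_system \<Rightarrow> 'a signed set \<Rightarrow> 'a signed set \<Rightarrow> bool) \<Rightarrow> bool" where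
  "minor_closed P \<longleftrightarrow>
     (\<forall>M \<C> \<D> F G. P M \<C> \<D> \<longrightarrow> F \<subseteq> ground M \<longrightarrow> G \<subseteq> ground M \<longrightarrow> F \<inter> G = {} \<longrightarrow>
        P (minor M F G) (minor_circuit_sig M \<C> F G) (minor_cocircuit_sig M \<D> F G))"

end

theory Submission
  imports Defs
begin

text \<open>The heart of the matter is that the signings which circuits of \<open>M\<close> induce on a circuit of a
  minor are unique up to negation; by duality the same holds for cocircuits. Uniqueness makes the
  induced signatures of a minor of a minor coincide with those of the corresponding minor of \<open>M\<close>, so
  that the Farkas property is inherited.\<close>

section \<open>Bases and duality\<close>

text \<open>Many circuits of \<open>M\<close> can leave the same trace on a minor, and the
  definition of the induced signatures does not make their signs match. This is the obstacle to the
  induced family being a signature at all. It is removed by the Farkas property: in a two-element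
  minor whose whole ground set is both a circuit and a cocircuit, no signed set with that support
  can belong to both induced signatures, since a reorientation would make it positive on both sides.
  Existence of an induced signing, by contrast, comes from lifting circuits and needs only the
  matroid axioms and a signature of \<open>M\<close>. Since bases may be infinite, sizes cannot be
  compared; the arguments rest on maximality and on the fact that no base properly contains
  another.\<close>

definition basis_of :: "'a set_system \<Rightarrow> 'a set \<Rightarrow> 'a set \<Rightarrow> bool" where
  "basis_of M X J \<longleftrightarrow> J \<in> indep M \<and> J \<subseteq> X \<and> (\<forall>K\<in>indep M. J \<subseteq> K \<and> K \<subseteq> X \<longrightarrow> K = J)"

lemma basis_of_eqI: "basis_of M X J \<Longrightarrow> K \<in> indep M \<Longrightarrow> J \<subseteq> K \<Longrightarrow> K \<subseteq> X \<Longrightarrow> K = J"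
  by (auto simp: basis_of_def)

lemma basis_of_indep: "J \<in> indep M \<Longrightarrow> basis_of M J J"
  by (auto simp: basis_of_def)

lemma base_indep: "base M B \<Longrightarrow> B \<in> indep M"
  by (simp add: base_def)

lemma base_antichain: "base M B \<Longrightarrow> base M B' \<Longrightarrow> B \<subseteq> B' \<Longrightarrow> B = B'"
  by (auto simp: base_def)

lemma matroid_indep_ground: "matroid M \<Longrightarrow> I \<in> indep M \<Longrightarrow> I \<subseteq> ground M"
  by (auto simp: matroid_def)

lemma matroid_empty_indep: "matroid M \<Longrightarrow> {} \<in> indep M"
  by (simp add: matroid_def)

lemma matroid_indep_subset:
  assumes "matroid M" "J \<in> indep M" "I \<subseteq> J" shows "I \<in> indep M"
proof -
  have "\<forall>I J. J \<in> indep M \<longrightarrow> I \<subseteq> J \<longrightarrow> I \<in> indep M"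
    using assms(1) unfolding matroid_def by (elim conjE)
  then show ?thesis using assms(2,3) by blast
qed

lemma matroid_augment:
  assumes "matroid M" "I \<in> indep M" "\<not> base M I" "base M B"
  shows "\<exists>x\<in>B - I. insert x I \<in> indep M"
proof -
  have "\<forall>I B. I \<in> indep M \<longrightarrow> \<not> base M I \<longrightarrow> base M B \<longrightarrow> (\<exists>x\<in>B - I. insert x I \<in> indep M)"
    using assms(1) unfolding matroid_def by (elim conjE)
  then show ?thesis using assms(2-4) by blast
qed

lemma matroid_basis_extend:
  assumes "matroid M" "I \<in> indep M" "I \<subseteq> X" "X \<subseteq> ground M"
  obtains J where "basis_of M X J" "I \<subseteq> J"
proof -
  have "\<forall>I X. I \<in> indep M \<longrightarrow> I \<subseteq> X \<longrightarrow> X \<subseteq> ground M \<longrightarrow>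
        (\<exists>J\<in>indep M. I \<subseteq> J \<and> J \<subseteq> X \<and> (\<forall>K\<in>indep M. J \<subseteq> K \<and> K \<subseteq> X \<longrightarrow> K = J))"
    using assms(1) unfolding matroid_def by (elim conjE)
  then have "\<exists>J\<in>indep M. I \<subseteq> J \<and> J \<subseteq> X \<and> (\<forall>K\<in>indep M. J \<subseteq> K \<and> K \<subseteq> X \<longrightarrow> K = J)"
    using assms(2-4) by simp
  then show ?thesis using that unfolding basis_of_def by blast
qed

lemma matroid_basis_exists:
  assumes "matroid M" "X \<subseteq> ground M"
  obtains J where "basis_of M X J"
  using matroid_basis_extend[OF assms(1) matroid_empty_indep] assms by blast

lemma base_iff_basis_of_ground: "matroid M \<Longrightarrow> base M B \<longleftrightarrow> basis_of M (ground M) B"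
  unfolding base_def basis_of_def by (blast dest: matroid_indep_ground)

text \<open>(IM) gives a maximal independent \<open>J\<close> between \<open>I\<close> and
  \<open>I \<union> B\<close>. If \<open>J\<close> were not a base, (I3) would add to it an element
  of \<open>B\<close>, against this maximality.\<close>

lemma matroid_base_extend_into:
  assumes M: "matroid M" and I: "I \<in> indep M" and B: "base M B"
  obtains B' where "base M B'" "I \<subseteq> B'" "B' \<subseteq> I \<union> B"
proof -
  have "I \<union> B \<subseteq> ground M"
    using M I B by (blast dest: matroid_indep_ground base_indep)
  then obtain J where J: "basis_of M (I \<union> B) J" "I \<subseteq> J"
    using matroid_basis_extend[OF M I, of "I \<union> B"] by blast
  have Ji: "J \<in> indep M" "J \<subseteq> I \<union> B"
    using J by (auto simp: basis_of_def)
  have "base M J"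
  proof (rule ccontr)
    assume "\<not> base M J"
    then obtain x where x: "x \<in> B - J" "insert x J \<in> indep M"
      using matroid_augment[OF M Ji(1) _ B] by blast
    then have "insert x J = J"
      using basis_of_eqI[OF J(1)] Ji by blast
    with x show False by blast
  qed
  then show ?thesis using that J Ji by blast
qed

lemma matroid_base_exists:
  assumes "matroid M" obtains B where "base M B"
  using matroid_basis_exists[OF assms order_refl] base_iff_basis_of_ground[OF assms] by blast

lemma matroid_indep_iff: "matroid M \<Longrightarrow> I \<in> indep M \<longleftrightarrow> (\<exists>B. base M B \<and> I \<subseteq> B)"
  by (meson base_indep matroid_base_exists matroid_base_extend_into matroid_indep_subset)

lemma base_basis_of_Int:
  assumes "base M B" "basis_of M X J" "J \<subseteq> B" "matroid M"
  shows "B \<inter> X = J"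
proof (rule basis_of_eqI[OF assms(2)])
  show "B \<inter> X \<in> indep M"
    by (rule matroid_indep_subset[OF assms(4) base_indep[OF assms(1)]]) blast
qed (use assms in \<open>auto simp: basis_of_def\<close>)

text \<open>The part of a base inside \<open>X\<close> can be replaced by any prescribed basis
  \<open>J\<close> of \<open>X\<close> without new elements outside \<open>X\<close>: extend
  \<open>J\<close> within \<open>J \<union> B\<close>; maximality of \<open>J\<close> then fixes the
  trace on \<open>X\<close>.\<close>

lemma base_exchange_basis_of:
  assumes M: "matroid M" and J: "basis_of M X J" and B: "base M B"
  obtains B' where "base M B'" "B' \<inter> X = J" "B' - X \<subseteq> B - X"
proof -
  have "J \<in> indep M" using J by (simp add: basis_of_def)
  then obtain B' where B': "base M B'" "J \<subseteq> B'" "B' \<subseteq> J \<union> B"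
    using matroid_base_extend_into[OF M _ B] by blast
  moreover have "B' \<inter> X = J" using base_basis_of_Int[OF B'(1) J B'(2) M] .
  moreover have "B' - X \<subseteq> B - X" using B' J by (auto simp: basis_of_def)
  ultimately show ?thesis using that by blast
qed

section \<open>Duality, and the dual as a matroid\<close>

lemma ground_dual [simp]: "ground (dual M) = ground M"
  by (simp add: dual_def)

lemma ground_delete [simp]: "ground (delete M G) = ground M - G"
  by (simp add: delete_def)

lemma ground_contract [simp]: "ground (contract M F) = ground M - F"
  by (simp add: contract_def)

lemma indep_dual: "I \<in> indep (dual M) \<longleftrightarrow> (\<exists>B. base M B \<and> I \<subseteq> ground M - B)"
  by (simp add: dual_def)

lemma indep_delete: "I \<in> indep (delete M G) \<longleftrightarrow> I \<in> indep M \<and> I \<inter> G = {}"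
  by (simp add: delete_def)

text \<open>Complementation reverses inclusion, so maximality among the sets that avoid some base
  becomes the antichain property of bases.\<close>

lemma base_dual:
  assumes M: "matroid M" and K: "K \<subseteq> ground M"
  shows "base (dual M) K \<longleftrightarrow> base M (ground M - K)"
proof
  assume b: "base (dual M) K"
  then obtain B where B: "base M B" "K \<subseteq> ground M - B"
    by (auto simp: base_def indep_dual)
  have "ground M - B \<in> indep (dual M)" using B by (auto simp: indep_dual)
  then have "ground M - B = K" using b B unfolding base_def by blast
  moreover have "B \<subseteq> ground M" using M B by (blast dest: matroid_indep_ground base_indep)
  ultimately show "base M (ground M - K)" using B(1) by (auto simp: double_diff)
next
  assume b: "base M (ground M - K)"
  have "I = K" if "I \<in> indep (dual M)" "K \<subseteq> I" for I
  proof -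
    obtain B where B: "base M B" "I \<subseteq> ground M - B" using \<open>I \<in> _\<close> by (auto simp: indep_dual)
    have "B \<subseteq> ground M" using M B by (blast dest: matroid_indep_ground base_indep)
    then have "B \<subseteq> ground M - K" using B that by blast
    then have "B = ground M - K" using base_antichain[OF B(1) b] by blast
    then show ?thesis using B that K by blast
  qed
  moreover have "K \<in> indep (dual M)" using b K by (auto simp: indep_dual)
  ultimately show "base (dual M) K" by (auto simp: base_def)
qed

text \<open>This is the duality of restriction and contraction, in terms of bases: the right-hand
  side says that \<open>X - K\<close> is a base of the contraction of \<open>ground M - X\<close>,
  with \<open>J\<close> standing for the contracted set. A base avoiding \<open>K\<close> can be
  exchanged outside \<open>X\<close> so as to meet \<open>ground M - X\<close> in \<open>J\<close>,
  which makes the two maximality conditions comparable.\<close>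

lemma basis_of_dual_iff:
  assumes M: "matroid M" and J: "basis_of M (ground M - X) J"
    and X: "X \<subseteq> ground M" and K: "K \<subseteq> X"
  shows "basis_of (dual M) X K \<longleftrightarrow> base M (J \<union> (X - K))"
proof
  assume b: "basis_of (dual M) X K"
  then obtain B where B: "base M B" "K \<subseteq> ground M - B"
    by (auto simp: basis_of_def indep_dual)
  obtain B' where B': "base M B'" "B' \<inter> (ground M - X) = J"
      "B' - (ground M - X) \<subseteq> B - (ground M - X)"
    using base_exchange_basis_of[OF M J B(1)] .
  have B'E: "B' \<subseteq> ground M" using M B' by (blast dest: matroid_indep_ground base_indep)
  have "X - B' \<in> indep (dual M)" using B' X by (auto simp: indep_dual)
  moreover have "K \<subseteq> X - B'" using K B B' X by blast
  ultimately have "X - B' = K" using basis_of_eqI[OF b] by blast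
  then have "J \<union> (X - K) = B'" using B' B'E K by blast
  then show "base M (J \<union> (X - K))" using B' by simp
next
  assume b: "base M (J \<union> (X - K))"
  have JX: "J \<subseteq> ground M - X" using J by (simp add: basis_of_def)
  have "I = K" if I: "I \<in> indep (dual M)" "K \<subseteq> I" "I \<subseteq> X" for I
  proof -
    obtain B where B: "base M B" "I \<subseteq> ground M - B" using I by (auto simp: indep_dual)
    obtain B' where B': "base M B'" "B' \<inter> (ground M - X) = J"
        "B' - (ground M - X) \<subseteq> B - (ground M - X)"
      using base_exchange_basis_of[OF M J B(1)] .
    have B'E: "B' \<subseteq> ground M" using M B' by (blast dest: matroid_indep_ground base_indep)
    have "B' \<subseteq> J \<union> (X - K)" using B' B'E B I by blast
    then have "B' = J \<union> (X - K)" using base_antichain[OF B'(1) b] by blast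
    then show ?thesis using B B' I JX by blast
  qed
  moreover have "K \<in> indep (dual M)" using b K X JX by (auto simp: indep_dual)
  ultimately show "basis_of (dual M) X K" using K by (auto simp: basis_of_def)
qed

lemma matroid_dual:
  assumes M: "matroid M" shows "matroid (dual M)"
proof -
  obtain B0 where B0: "base M B0" using matroid_base_exists[OF M] .
  have aug: "\<exists>x\<in>B - I. insert x I \<in> indep (dual M)"
    if I: "I \<in> indep (dual M)" "\<not> base (dual M) I" and B: "base (dual M) B" for I B
  proof (rule ccontr)
    assume no: "\<not> ?thesis"
    have BE: "B \<subseteq> ground M" using B by (auto simp: base_def indep_dual)
    have IE: "I \<subseteq> ground M" using I by (auto simp: indep_dual)
    obtain B1 where B1: "base M B1" "I \<subseteq> ground M - B1" using I by (auto simp: indep_dual)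
    have b2: "base M (ground M - B)" using base_dual[OF M BE] B by blast
    have "ground M - B - I \<in> indep M"
      by (rule matroid_indep_subset[OF M base_indep[OF b2]]) blast
    then obtain B' where B': "base M B'" "ground M - B - I \<subseteq> B'" "B' \<subseteq> (ground M - B - I) \<union> B1"
      using matroid_base_extend_into[OF M _ B1(1)] by blast
    \<comment> \<open>\<open>B'\<close> contains everything outside \<open>B\<close> and
      \<open>I\<close>, so a missed \<open>x\<close> would lie in \<open>B - I\<close>; then
      \<open>B'\<close> would witness that \<open>insert x I\<close> is independent in the
      dual.\<close>
    have "x \<in> B'" if "x \<in> ground M - I" for x
    proof (rule ccontr)
      assume x: "x \<notin> B'"
      then have "x \<in> B - I" using B' that by blast
      moreover have "insert x I \<in> indep (dual M)"
        using x B' B1 IE that by (auto simp: indep_dual intro!: exI[of _ B'])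
      ultimately show False using no by blast
    qed
    moreover have "B' \<subseteq> ground M - I"
      using B' B1 M by (blast dest: matroid_indep_ground base_indep)
    ultimately have "B' = ground M - I" by blast
    then show False using B'(1) I(2) base_dual[OF M IE] by simp
  qed
  have ext: "\<exists>J\<in>indep (dual M). I \<subseteq> J \<and> J \<subseteq> X \<and>
      (\<forall>K\<in>indep (dual M). J \<subseteq> K \<and> K \<subseteq> X \<longrightarrow> K = J)"
    if I: "I \<in> indep (dual M)" "I \<subseteq> X" and X: "X \<subseteq> ground M" for I X
  proof -
    obtain B where B: "base M B" "I \<subseteq> ground M - B" using I by (auto simp: indep_dual)
    \<comment> \<open>The base \<open>B\<close> avoiding \<open>I\<close> is exchanged outside
      \<open>X\<close> for one meeting \<open>ground M - X\<close> in a basis. Inside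
      \<open>X\<close> it gains nothing, so the part of \<open>X\<close> that it misses still
      contains \<open>I\<close>, and that part is maximal by
      \<open>basis_of_dual_iff\<close>.\<close>
    obtain J where J: "basis_of M (ground M - X) J"
      using matroid_basis_exists[OF M] by (meson Diff_subset)
    obtain B' where B': "base M B'" "B' \<inter> (ground M - X) = J"
        "B' - (ground M - X) \<subseteq> B - (ground M - X)"
      using base_exchange_basis_of[OF M J B(1)] .
    have "B' \<subseteq> ground M" using M B' by (blast dest: matroid_indep_ground base_indep)
    then have "J \<union> (X - (X - B')) = B'" using B' X by blast
    then have "basis_of (dual M) X (X - B')"
      using basis_of_dual_iff[OF M J X] B'(1) by simp
    moreover have "I \<subseteq> X - B'" using I B B' X by blast
    ultimately show ?thesis unfolding basis_of_def by blast
  qed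
  show ?thesis unfolding matroid_def
  proof (intro conjI allI impI)
    show "indep (dual M) \<subseteq> Pow (ground (dual M))" by (auto simp: indep_dual)
    show "{} \<in> indep (dual M)" using B0 by (auto simp: indep_dual)
    show "I \<in> indep (dual M)" if "J \<in> indep (dual M)" "I \<subseteq> J" for I J
      using that by (auto simp: indep_dual)
  qed (use aug ext in auto)
qed

lemma dual_dual:
  assumes M: "matroid M" shows "dual (dual M) = M"
proof (rule set_system.expand, intro conjI set_eqI)
  fix I
  have sub: "B \<subseteq> ground M" if "base (dual M) B" for B
    using base_indep[OF that] by (auto simp: indep_dual)
  have "I \<in> indep (dual (dual M)) \<longleftrightarrow>
      (\<exists>B. B \<subseteq> ground M \<and> base M (ground M - B) \<and> I \<subseteq> ground M - B)"
    unfolding indep_dual[of I "dual M"] ground_dual using base_dual[OF M] sub by blast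
  also have "\<dots> \<longleftrightarrow> (\<exists>B. base M B \<and> I \<subseteq> B)"
  proof
    assume "\<exists>B. base M B \<and> I \<subseteq> B"
    then obtain B where B: "base M B" "I \<subseteq> B" by blast
    then have "ground M - (ground M - B) = B"
      using matroid_indep_ground[OF M base_indep] by blast
    then show "\<exists>B\<subseteq>ground M. base M (ground M - B) \<and> I \<subseteq> ground M - B"
      using B by (intro exI[of _ "ground M - B"]) auto
  qed blast
  finally show "I \<in> indep (dual (dual M)) \<longleftrightarrow> I \<in> indep M"
    using matroid_indep_iff[OF M] by blast
qed simp

section \<open>Minors\<close>

lemma basis_of_delete:
  assumes "X \<inter> G = {}"
  shows "basis_of (delete M G) X J \<longleftrightarrow> basis_of M X J"
proof -
  have "K \<in> indep (delete M G) \<longleftrightarrow> K \<in> indep M" if "K \<subseteq> X" for K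
    using that assms by (auto simp: indep_delete)
  then show ?thesis unfolding basis_of_def by metis
qed

lemma base_delete:
  assumes M: "matroid M"
  shows "base (delete M G) B \<longleftrightarrow> basis_of M (ground M - G) B"
proof -
  have "K \<in> indep (delete M G) \<longleftrightarrow> K \<in> indep M \<and> K \<subseteq> ground M - G" for K
    using matroid_indep_ground[OF M, of K] by (auto simp: indep_delete)
  then show ?thesis unfolding basis_of_def base_def by metis
qed

lemma matroid_delete:
  assumes M: "matroid M" shows "matroid (delete M G)"
proof -
  define X where "X = ground M - G"
  have ind: "I \<in> indep (delete M G) \<longleftrightarrow> I \<in> indep M \<and> I \<subseteq> X" for I
    using M by (auto simp: indep_delete X_def dest: matroid_indep_ground)
  have aug: "\<exists>x\<in>B - I. insert x I \<in> indep M \<and> insert x I \<subseteq> X"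
    if I: "I \<in> indep M" "I \<subseteq> X" "\<not> basis_of M X I" and B: "basis_of M X B" for I B
  proof (rule ccontr)
    assume no: "\<not> ?thesis"
    have BX: "B \<in> indep M" "B \<subseteq> X" using B by (auto simp: basis_of_def)
    obtain Y where Y: "Y \<in> indep M" "I \<subset> Y" "Y \<subseteq> X" using I by (auto simp: basis_of_def)
    obtain B1 where B1: "base M B1" "B \<subseteq> B1" using matroid_indep_iff[OF M] BX by blast
    have B1X: "B1 \<inter> X = B" using base_basis_of_Int[OF B1(1) B B1(2) M] .
    obtain B2 where B2: "base M B2" "I \<subseteq> B2" "B2 \<subseteq> I \<union> B1"
      using matroid_base_extend_into[OF M I(1) B1(1)] .
    have B2I: "B2 \<inter> X \<subseteq> I"
    proof
      fix x assume x: "x \<in> B2 \<inter> X"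
      show "x \<in> I"
      proof (rule ccontr)
        assume "x \<notin> I"
        then have "x \<in> B - I" using x B2 B1X by blast
        moreover have "insert x I \<in> indep M"
          using matroid_indep_subset[OF M base_indep[OF B2(1)]] x B2 by blast
        ultimately show False using no x I by blast
      qed
    qed
    obtain B3 where B3: "base M B3" "Y \<subseteq> B3" "B3 \<subseteq> Y \<union> B2"
      using matroid_base_extend_into[OF M Y(1) B2(1)] .
    obtain B4 where B4: "base M B4" "B4 \<inter> X = B" "B4 - X \<subseteq> B3 - X"
      using base_exchange_basis_of[OF M B B3(1)] .
    \<comment> \<open>Outside \<open>X\<close> the traces shrink from \<open>B1\<close> through
      \<open>B2\<close> and \<open>B3\<close> to \<open>B4\<close>, while \<open>B1\<close> and
      \<open>B4\<close> both meet \<open>X\<close> in \<open>B\<close>. Hence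
      \<open>B4 = B1\<close>, and all four agree outside \<open>X\<close>. Then \<open>B2\<close>
      lies in \<open>B3\<close>, so they are equal, although \<open>B3\<close> contains
      \<open>Y\<close>, which properly contains the trace \<open>I\<close> of
      \<open>B2\<close>.\<close>
    have "B4 \<subseteq> B1" using B4 B3 B2 Y I B1X by blast
    then have "B4 = B1" using base_antichain B4 B1 by blast
    then have "B2 \<subseteq> B3" using B2 B2I B4 Y B3 by blast
    then have "B2 = B3" using base_antichain B2 B3 by blast
    then show False using Y B3 B2I by blast
  qed
  show ?thesis unfolding matroid_def
  proof (intro conjI allI impI)
    show "indep (delete M G) \<subseteq> Pow (ground (delete M G))"
      using ind by (auto simp: X_def)
    show "{} \<in> indep (delete M G)" using matroid_empty_indep[OF M] ind by auto
    show "I \<in> indep (delete M G)" if "J \<in> indep (delete M G)" "I \<subseteq> J" for I J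
      using matroid_indep_subset[OF M _ that(2)] that unfolding ind by blast
    show "\<exists>x\<in>B - I. insert x I \<in> indep (delete M G)"
      if "I \<in> indep (delete M G)" "\<not> base (delete M G) I" "base (delete M G) B" for I B
      using that aug[of I B] unfolding base_delete[OF M] ind X_def by simp
    show "\<exists>J\<in>indep (delete M G). I \<subseteq> J \<and> J \<subseteq> Y \<and>
        (\<forall>K\<in>indep (delete M G). J \<subseteq> K \<and> K \<subseteq> Y \<longrightarrow> K = J)"
      if "I \<in> indep (delete M G)" "I \<subseteq> Y" "Y \<subseteq> ground (delete M G)" for I Y
    proof -
      have Y: "Y \<subseteq> ground M" "Y \<inter> G = {}" and Ii: "I \<in> indep M" "I \<subseteq> Y"
        using that by (auto simp: indep_delete)
      obtain J where J: "basis_of M Y J" "I \<subseteq> J"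
        using matroid_basis_extend[OF M Ii Y(1)] .
      have "basis_of (delete M G) Y J" using J(1) basis_of_delete[OF Y(2)] by blast
      then show ?thesis using J(2) unfolding basis_of_def by blast
    qed
  qed
qed

section \<open>Contraction and minors through independent sets\<close>

lemma matroid_contract: "matroid M \<Longrightarrow> matroid (contract M F)"
  unfolding contract_def by (intro matroid_dual matroid_delete)

lemma matroid_minor: "matroid M \<Longrightarrow> matroid (minor M F G)"
  unfolding minor_def by (intro matroid_contract matroid_delete)

text \<open>Complementation within \<open>ground M - F\<close> leads to a basis of that set in the
  dual; \<open>basis_of_dual_iff\<close> leads back to a base of \<open>M\<close>.\<close>

lemma base_contract:
  assumes M: "matroid M" and F: "F \<subseteq> ground M" and J: "basis_of M F J"
    and B: "B \<subseteq> ground M - F"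
  shows "base (contract M F) B \<longleftrightarrow> base M (J \<union> B)"
proof -
  let ?X = "ground M - F"
  have J': "basis_of M (ground M - ?X) J" using J F by (simp add: double_diff)
  have "base (contract M F) B \<longleftrightarrow> base (delete (dual M) F) (?X - B)"
    unfolding contract_def using base_dual[OF matroid_delete[OF matroid_dual[OF M]], of B F] B
    by simp
  also have "\<dots> \<longleftrightarrow> base M (J \<union> (?X - (?X - B)))"
    using base_delete[OF matroid_dual[OF M]] basis_of_dual_iff[OF M J'] by simp
  also have "?X - (?X - B) = B" using B by blast
  finally show ?thesis .
qed

text \<open>With this test through any one basis \<open>J\<close> of \<open>F\<close>, independence
  in contractions can be handled without the double dual of the definition.\<close>

lemma indep_contract:
  assumes M: "matroid M" and F: "F \<subseteq> ground M" and J: "basis_of M F J"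
  shows "I \<in> indep (contract M F) \<longleftrightarrow> I \<subseteq> ground M - F \<and> J \<union> I \<in> indep M"
proof
  assume "I \<in> indep (contract M F)"
  then obtain B where B: "base (contract M F) B" "I \<subseteq> B"
    using matroid_indep_iff[OF matroid_contract[OF M]] by blast
  have BE: "B \<subseteq> ground M - F"
    using matroid_indep_ground[OF matroid_contract[OF M] base_indep[OF B(1)]] by simp
  then have "base M (J \<union> B)" using B base_contract[OF M F J] by blast
  then show "I \<subseteq> ground M - F \<and> J \<union> I \<in> indep M"
    unfolding matroid_indep_iff[OF M] using B BE by blast
next
  assume I: "I \<subseteq> ground M - F \<and> J \<union> I \<in> indep M"
  then obtain B where B: "base M B" "J \<union> I \<subseteq> B" using matroid_indep_iff[OF M] by blast
  have "B \<inter> F = J" using base_basis_of_Int[OF B(1) J _ M] B by blast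
  then have "J \<union> (B - F) = B" by blast
  moreover have "B - F \<subseteq> ground M - F"
    using matroid_indep_ground[OF M base_indep[OF B(1)]] by blast
  ultimately have "base (contract M F) (B - F)" using base_contract[OF M F J] B by simp
  moreover have "I \<subseteq> B - F" using B I by blast
  ultimately show "I \<in> indep (contract M F)"
    using matroid_indep_iff[OF matroid_contract[OF M]] by blast
qed

lemma indep_minor:
  assumes "matroid M" "F \<subseteq> ground M" "basis_of M F J"
  shows "I \<in> indep (minor M F G) \<longleftrightarrow> I \<subseteq> ground M - (F \<union> G) \<and> J \<union> I \<in> indep M"
  unfolding minor_def indep_delete indep_contract[OF assms] by blast

text \<open>As \<open>F\<close> and \<open>G\<close> are disjoint, a basis \<open>J\<close> of
  \<open>F\<close> avoids \<open>G\<close> and remains a basis after the deletion, so both sides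
  test the same sets \<open>J \<union> I\<close>.\<close>

lemma minor_eq_contract_delete:
  assumes M: "matroid M" and F: "F \<subseteq> ground M" and FG: "F \<inter> G = {}"
  shows "minor M F G = contract (delete M G) F"
proof (rule set_system.expand, intro conjI set_eqI)
  fix I
  obtain J where J: "basis_of M F J" using matroid_basis_exists[OF M F] .
  then have J': "basis_of (delete M G) F J" and JF: "J \<inter> G = {}"
    using FG basis_of_delete[of F G M J] by (auto simp: basis_of_def)
  have F': "F \<subseteq> ground (delete M G)" using F FG by auto
  show "I \<in> indep (minor M F G) \<longleftrightarrow> I \<in> indep (contract (delete M G) F)"
    unfolding indep_minor[OF M F J] indep_contract[OF matroid_delete[OF M] F' J'] indep_delete
    using JF by auto
qed (auto simp: ground_minor)

text \<open>Once the deletion comes first, the outer operation is a contraction, hence a dual, and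
  the two outer duals cancel.\<close>

lemma dual_minor:
  assumes M: "matroid M" and F: "F \<subseteq> ground M" and FG: "F \<inter> G = {}"
  shows "dual (minor M F G) = minor (dual M) G F"
  unfolding minor_eq_contract_delete[OF assms]
  by (simp add: contract_def minor_def dual_dual[OF M]
      dual_dual[OF matroid_delete[OF matroid_dual[OF matroid_delete[OF M]]]])

lemma delete_delete: "delete (delete M G) G' = delete M (G \<union> G')"
  by (rule set_system.expand) (auto simp: indep_delete)

lemma contract_contract:
  "matroid M \<Longrightarrow> contract (contract M F) F' = contract M (F \<union> F')"
  by (simp add: contract_def dual_dual matroid_delete matroid_dual delete_delete)

text \<open>The deletion of \<open>G\<close> has to move past the contraction of \<open>F'\<close>;
  disjointness lets the two commute.\<close>

lemma minor_minor:
  assumes M: "matroid M" and F: "F' \<subseteq> ground M - F" and G: "F' \<inter> G = {}"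
  shows "minor (minor M F G) F' G' = minor M (F \<union> F') (G \<union> G')"
proof -
  have "minor (minor M F G) F' G' = delete (contract (delete (contract M F) G) F') G'"
    by (simp add: minor_def)
  also have "contract (delete (contract M F) G) F' = minor (contract M F) F' G"
    using minor_eq_contract_delete[OF matroid_contract[OF M], of F' F G] F G by simp
  finally show ?thesis
    by (simp add: minor_def contract_contract[OF M] delete_delete)
qed

section \<open>Circuits\<close>

lemma circuit_dependent: "circuit M D \<Longrightarrow> D \<notin> indep M"
  by (simp add: circuit_def)

lemma circuit_psubset_indep: "circuit M D \<Longrightarrow> I \<subset> D \<Longrightarrow> I \<in> indep M"
  by (simp add: circuit_def)

lemma circuit_nonempty: "matroid M \<Longrightarrow> circuit M D \<Longrightarrow> D \<noteq> {}"
  using matroid_empty_indep by (auto simp: circuit_def)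

lemma dependent_contains_circuit:
  assumes M: "matroid M" and D: "D \<subseteq> ground M" "D \<notin> indep M"
  obtains C where "circuit M C" "C \<subseteq> D"
proof -
  obtain I where I: "basis_of M D I" using matroid_basis_exists[OF M D(1)] .
  then have Ii: "I \<in> indep M" "I \<subseteq> D" by (auto simp: basis_of_def)
  then have "I \<noteq> D" using D(2) by blast
  then obtain x where x: "x \<in> D" "x \<notin> I" using Ii(2) by blast
  have dep: "insert x I \<notin> indep M" using basis_of_eqI[OF I, of "insert x I"] x Ii by blast
  \<comment> \<open>The fundamental circuit of \<open>x\<close> over \<open>I\<close>: besides
    \<open>x\<close>, it consists of the elements that \<open>x\<close> can replace. A minimal
    dependent subset cannot be found by counting when \<open>D\<close> is infinite.\<close>
  define C where "C = insert x {y\<in>I. insert x (I - {y}) \<in> indep M}"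
  have CX: "C \<subseteq> insert x I" by (auto simp: C_def)
  have XE: "insert x I \<subseteq> ground M" using x Ii D by blast
  have "C \<notin> indep M"
  proof
    assume Ci: "C \<in> indep M"
    \<comment> \<open>In the restriction to \<open>insert x I\<close> the set \<open>I\<close> is a
      base. A base \<open>B\<close> containing \<open>C\<close> would miss some \<open>y\<close> in
      \<open>I\<close>; augmenting \<open>I - {y}\<close> from \<open>B\<close> can only add
      \<open>x\<close>, which puts \<open>y\<close> into \<open>C\<close> and hence into
      \<open>B\<close>.\<close>
    define R where "R = delete M (ground M - insert x I)"
    have R: "matroid R" unfolding R_def by (rule matroid_delete[OF M])
    have ind: "K \<in> indep R \<longleftrightarrow> K \<in> indep M \<and> K \<subseteq> insert x I" for K
      using M by (auto simp: R_def indep_delete dest: matroid_indep_ground)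
    have bI: "base R I" unfolding base_def
    proof (intro conjI ballI impI)
      fix K assume K: "K \<in> indep R" "I \<subseteq> K"
      then have "K \<noteq> insert x I" "K \<subseteq> insert x I" using dep ind by auto
      then show "K = I" using K(2) by blast
    qed (use Ii ind in auto)
    obtain B where B: "base R B" "C \<subseteq> B" using matroid_indep_iff[OF R] ind Ci CX by blast
    have BX: "B \<in> indep M" "B \<subseteq> insert x I" using base_indep[OF B(1)] ind by auto
    have "x \<in> B" using B by (auto simp: C_def)
    have "B \<noteq> insert x I" using BX(1) dep by blast
    then obtain y where y: "y \<in> I" "y \<notin> B" using BX(2) \<open>x \<in> B\<close> by blast
    have "I - {y} \<in> indep R"
      using matroid_indep_subset[OF M Ii(1), of "I - {y}"] by (auto simp: ind)
    moreover have "\<not> base R (I - {y})" using bI y base_antichain[of R "I - {y}" I] by blast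
    ultimately obtain z where z: "z \<in> B - (I - {y})" "insert z (I - {y}) \<in> indep R"
      using matroid_augment[OF R _ _ B(1)] by blast
    then have "z = x" using BX y by blast
    then have "y \<in> C" using z y ind by (auto simp: C_def)
    then show False using B y by blast
  qed
  moreover have "K \<in> indep M" if K: "K \<subset> C" for K
  proof -
    obtain z where z: "z \<in> C" "z \<notin> K" using K by blast
    have "K \<subseteq> insert x I" using K CX by blast
    show ?thesis
    proof (cases "z = x")
      case True
      then have "K \<subseteq> I" using \<open>K \<subseteq> insert x I\<close> z by blast
      then show ?thesis by (rule matroid_indep_subset[OF M Ii(1)])
    next
      case False
      then have "insert x (I - {z}) \<in> indep M" using z by (auto simp: C_def)
      then show ?thesis
        by (rule matroid_indep_subset[OF M]) (use \<open>K \<subseteq> insert x I\<close> z in blast)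
    qed
  qed
  ultimately have "circuit M C" using CX XE by (auto simp: circuit_def)
  then show ?thesis using that CX x Ii by blast
qed

text \<open>For a basis \<open>J\<close> of \<open>F\<close> the set \<open>J \<union> D\<close> is
  dependent, but it becomes independent when \<open>D\<close> is replaced by a proper subset. So a
  circuit inside it must contain all of \<open>D\<close>.\<close>

lemma circuit_minor_lift:
  assumes M: "matroid M" and F: "F \<subseteq> ground M" and D: "circuit (minor M F G) D"
  obtains C where "circuit M C" "C \<subseteq> D \<union> F" "D \<subseteq> C"
proof -
  obtain J where J: "basis_of M F J" using matroid_basis_exists[OF M F] .
  have Ji: "J \<subseteq> F" "J \<in> indep M" using J by (auto simp: basis_of_def)
  have ind: "I \<in> indep (minor M F G) \<longleftrightarrow> J \<union> I \<in> indep M" if "I \<subseteq> D" for I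
    using that D indep_minor[OF M F J] by (auto simp: circuit_def ground_minor)
  have DE: "D \<subseteq> ground M - (F \<union> G)" using D by (auto simp: circuit_def ground_minor)
  have "J \<union> D \<notin> indep M" using circuit_dependent[OF D] ind by simp
  moreover have "J \<union> D \<subseteq> ground M" using Ji F DE by blast
  ultimately obtain C where C: "circuit M C" "C \<subseteq> J \<union> D"
    using dependent_contains_circuit[OF M] by blast
  have "D \<subseteq> C"
  proof (rule ccontr)
    assume "\<not> D \<subseteq> C"
    then have "C \<inter> D \<subset> D" by blast
    then have "J \<union> (C \<inter> D) \<in> indep M"
      using circuit_psubset_indep[OF D] ind[of "C \<inter> D"] by simp
    then have "C \<in> indep M" by (rule matroid_indep_subset[OF M]) (use C in blast)
    then show False using C by (simp add: circuit_def)
  qed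
  then show ?thesis using that C Ji by blast
qed

text \<open>Contracting all but two elements of a circuit leaves a parallel pair; deleting the rest
  leaves a matroid of rank one on that pair. It is presented as a minor of \<open>M\<close> itself
  because induced signatures depend on the presentation.\<close>

lemma circuit_minor_pair:
  assumes M: "matroid M" and F: "F \<subseteq> ground M"
    and D: "circuit (minor M F G) D" and ef: "e \<in> D" "f \<in> D" "e \<noteq> f"
  defines "N \<equiv> minor M (F \<union> (D - {e, f})) (ground M - F - D)"
  shows "circuit N {e, f}" and "cocircuit N {e, f}" and "ground N = {e, f}"
proof -
  let ?P = "minor M F G" and ?K = "D - {e, f}"
  have P: "matroid ?P" by (rule matroid_minor[OF M])
  have DE: "D \<subseteq> ground M - (F \<union> G)" using D by (auto simp: circuit_def ground_minor)
  have N: "N = minor ?P ?K (ground M - F - D)"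
  proof -
    have "minor ?P ?K (ground M - F - D) = minor M (F \<union> ?K) (G \<union> (ground M - F - D))"
      using minor_minor[OF M, of ?K F G] DE by blast
    also have "\<dots> = N"
    \<comment> \<open>The two deleted sets may differ, but they leave the same ground set, and
      independence is then tested in the same way.\<close>
    proof (rule set_system.expand, intro conjI set_eqI)
      fix I
      have g: "ground M - (F \<union> ?K \<union> (G \<union> (ground M - F - D)))
          = ground M - (F \<union> ?K \<union> (ground M - F - D))" using DE by blast
      have FK: "F \<union> ?K \<subseteq> ground M" using F DE by blast
      obtain J where J: "basis_of M (F \<union> ?K) J" using matroid_basis_exists[OF M FK] .
      show "I \<in> indep (minor M (F \<union> ?K) (G \<union> (ground M - F - D))) \<longleftrightarrow> I \<in> indep N"
        unfolding N_def indep_minor[OF M FK J] using g by simp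
    qed (use DE in \<open>auto simp: N_def ground_minor\<close>)
    finally show ?thesis by simp
  qed
  have K: "?K \<in> indep ?P" by (rule circuit_psubset_indep[OF D]) (use ef in blast)
  have KE: "?K \<subseteq> ground ?P" using DE by (auto simp: ground_minor)
  show gN: "ground N = {e, f}" using ef DE by (auto simp: N_def ground_minor)
  have g: "ground ?P - (?K \<union> (ground M - F - D)) = {e, f}"
    using ef DE by (auto simp: ground_minor)
  have ind: "I \<in> indep N \<longleftrightarrow> I \<subset> {e, f}" for I
  proof -
    have "I \<in> indep N \<longleftrightarrow> I \<subseteq> {e, f} \<and> ?K \<union> I \<in> indep ?P"
      unfolding N indep_minor[OF P KE basis_of_indep[OF K]] g ..
    moreover have "?K \<union> I \<in> indep ?P" if "I \<subset> {e, f}"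
    proof -
      have "?K \<union> I \<subset> D" using that ef by blast
      then show ?thesis using D by (simp add: circuit_def)
    qed
    moreover have "?K \<union> {e, f} \<notin> indep ?P"
    proof -
      have "?K \<union> {e, f} = D" using ef by blast
      then show ?thesis using D by (simp add: circuit_def)
    qed
    ultimately show ?thesis by (metis psubset_eq)
  qed
  show "circuit N {e, f}" unfolding circuit_def gN ind by blast
  \<comment> \<open>Complementation swaps the two bases, so the dual has the same independent
    sets.\<close>
  have "base N B \<longleftrightarrow> B = {e} \<or> B = {f}" for B
    unfolding base_def ind Ball_def using ef by auto
  then have "I \<in> indep (dual N) \<longleftrightarrow> I \<subset> {e, f}" for I
    unfolding indep_dual gN using ef by auto
  then show "cocircuit N {e, f}" unfolding cocircuit_def circuit_def by (simp add: gN)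
qed

section \<open>Signatures of minors\<close>

lemma supp_restrict [simp]: "supp (restrict_signed X A) = supp X \<inter> A"
  by (auto simp: supp_def restrict_signed_def)

lemma restrict_restrict [simp]:
  "restrict_signed (restrict_signed X A) B = restrict_signed X (A \<inter> B)"
  by (auto simp: restrict_signed_def)

lemma supp_opposite [simp]: "supp (opposite X) = supp X"
  by (auto simp: supp_def opposite_def)

lemma opposite_opposite [simp]: "opposite (opposite X) = X"
  by (simp add: opposite_def)

lemma restrict_opposite: "restrict_signed (opposite X) A = opposite (restrict_signed X A)"
  by (simp add: restrict_signed_def opposite_def)

lemma minor_circuit_sig_iff:
  "Y \<in> minor_circuit_sig M \<C> F G \<longleftrightarrow>
    (\<exists>X\<in>\<C>. Y = restrict_signed X (ground M - (F \<union> G)) \<and>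
      circuit (minor M F G) (supp X \<inter> (ground M - (F \<union> G))) \<and>
      supp X \<subseteq> ground M - (F \<union> G) \<union> F)"
  unfolding minor_circuit_sig_def Let_def ground_minor by auto

text \<open>Cocircuit statements thereby become circuit statements about the dual, with
  \<open>F\<close> and \<open>G\<close> exchanged, so only circuits need a separate
  treatment.\<close>

lemma minor_cocircuit_sig_eq:
  "matroid M \<Longrightarrow> F \<subseteq> ground M \<Longrightarrow> F \<inter> G = {} \<Longrightarrow>
    minor_cocircuit_sig M \<D> F G = minor_circuit_sig (dual M) \<D> G F"
  by (simp add: minor_cocircuit_sig_def minor_circuit_sig_def cocircuit_def dual_minor
      ground_minor Un_commute)

lemma circuit_signature_opposite:
  assumes "circuit_signature M \<C>" "X \<in> \<C>" shows "opposite X \<in> \<C>"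
proof -
  have "circuit M (supp X)" using assms by (simp add: circuit_signature_def)
  then obtain Z where Z: "{Y \<in> \<C>. supp Y = supp X} = {Z, opposite Z}"
    using assms unfolding circuit_signature_def by blast
  then have "X \<in> {Z, opposite Z}" using assms by blast
  then have "opposite X \<in> {Z, opposite Z}" by auto
  then show ?thesis using Z by blast
qed

lemma circuit_signature_ex:
  assumes "circuit_signature M \<C>" "circuit M D" obtains X where "X \<in> \<C>" "supp X = D"
proof -
  obtain Z where "{Y \<in> \<C>. supp Y = D} = {Z, opposite Z}"
    using assms unfolding circuit_signature_def by metis
  then have "Z \<in> {Y \<in> \<C>. supp Y = D}" by simp
  then show ?thesis using that by blast
qed

lemma circuit_signature_disjoint:
  "circuit_signature M \<C> \<Longrightarrow> X \<in> \<C> \<Longrightarrow> pos X \<inter> neg X = {}"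
  by (auto simp: circuit_signature_def signed_subset_def)

lemma minor_circuit_sig_opposite:
  assumes "circuit_signature M \<C>" "Y \<in> minor_circuit_sig M \<C> F G"
  shows "opposite Y \<in> minor_circuit_sig M \<C> F G"
  using assms circuit_signature_opposite[OF assms(1)]
  unfolding minor_circuit_sig_iff by (metis restrict_opposite supp_opposite)

text \<open>A lift of \<open>D\<close> to a circuit of \<open>M\<close> inside
  \<open>D \<union> F\<close> meets the ground set of the minor exactly in \<open>D\<close>, so the
  trace of its signing is admissible.\<close>

lemma minor_circuit_sig_ex:
  assumes M: "matroid M" and C: "circuit_signature M \<C>" and F: "F \<subseteq> ground M"
    and D: "circuit (minor M F G) D"
  obtains Y where "Y \<in> minor_circuit_sig M \<C> F G" "supp Y = D"
proof -
  obtain C where C': "circuit M C" "C \<subseteq> D \<union> F" "D \<subseteq> C" using circuit_minor_lift[OF M F D] .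
  have DE: "D \<subseteq> ground M - (F \<union> G)" using D by (auto simp: circuit_def ground_minor)
  obtain X where X: "X \<in> \<C>" "supp X = C" using circuit_signature_ex[OF C C'(1)] .
  have eq: "supp X \<inter> (ground M - (F \<union> G)) = D" using X C' DE by blast
  have "restrict_signed X (ground M - (F \<union> G)) \<in> minor_circuit_sig M \<C> F G"
    unfolding minor_circuit_sig_iff using X C' DE D eq by (intro bexI[of _ X]) auto
  then show ?thesis using that eq by (metis supp_restrict)
qed

lemma minor_circuit_sig_disjoint:
  assumes "circuit_signature M \<C>" "Y \<in> minor_circuit_sig M \<C> F G"
  shows "pos Y \<inter> neg Y = {}"
  using assms circuit_signature_disjoint[OF assms(1)]
  unfolding minor_circuit_sig_iff by (fastforce simp: restrict_signed_def)

section \<open>The Farkas property and uniqueness of induced signings\<close>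

text \<open>Reorienting along its own negative part makes \<open>X\<close> positive; as a member of
  both families it then satisfies both alternatives at \<open>e\<close>.\<close>

lemma farkas_not_common:
  assumes f: "farkas E (reorient (neg X) ` \<S>) (reorient (neg X) ` \<T>)"
    and X: "X \<in> \<S>" "X \<in> \<T>" "pos X \<inter> neg X = {}" "e \<in> supp X" "e \<in> E"
  shows False
proof -
  have "positive (reorient (neg X) X) \<and> e \<in> supp (reorient (neg X) X)"
    using X by (auto simp: positive_def reorient_def supp_def)
  then show False using f X unfolding farkas_def by blast
qed

lemma FP_oriented_farkas:
  assumes FP: "FP_oriented M \<C> \<D>" and "F \<subseteq> ground M" "G \<subseteq> ground M" "F \<inter> G = {}"
    and "A \<subseteq> ground (minor M F G)"
  shows "farkas (ground (minor M F G))
    (reorient A ` minor_circuit_sig M \<C> F G) (reorient A ` minor_cocircuit_sig M \<D> F G)"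
proof -
  have "\<forall>F G A. F \<subseteq> ground M \<longrightarrow> G \<subseteq> ground M \<longrightarrow> F \<inter> G = {} \<longrightarrow> A \<subseteq> ground (minor M F G) \<longrightarrow>
      farkas (ground (minor M F G))
        (reorient A ` minor_circuit_sig M \<C> F G) (reorient A ` minor_cocircuit_sig M \<D> F G)"
    using FP unfolding FP_oriented_def by (elim conjE)
  then show ?thesis using assms(2-) by simp
qed

lemma farkas_sym: "farkas E \<S> \<T> \<Longrightarrow> farkas E \<T> \<S>"
  unfolding farkas_def by metis

text \<open>The Farkas property is symmetric in its two families, and dualising a minor exchanges
  the contracted and the deleted set.\<close>

lemma FP_oriented_dual:
  assumes "FP_oriented M \<C> \<D>" shows "FP_oriented (dual M) \<D> \<C>"
proof -
  have M: "matroid M" and C: "circuit_signature M \<C>" and D: "circuit_signature (dual M) \<D>"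
    using assms by (auto simp: FP_oriented_def cocircuit_signature_def)
  have "farkas (ground (minor (dual M) F G))
          (reorient A ` minor_circuit_sig (dual M) \<D> F G)
          (reorient A ` minor_cocircuit_sig (dual M) \<C> F G)"
    if FG: "F \<subseteq> ground M" "G \<subseteq> ground M" "F \<inter> G = {}" and A: "A \<subseteq> ground (minor (dual M) F G)"
    for F G A
  proof -
    have g: "ground (minor (dual M) F G) = ground (minor M G F)" by (auto simp: ground_minor)
    have "minor_circuit_sig (dual M) \<D> F G = minor_cocircuit_sig M \<D> G F"
      using minor_cocircuit_sig_eq[OF M, of G F] FG by auto
    moreover have "minor_cocircuit_sig (dual M) \<C> F G = minor_circuit_sig M \<C> G F"
      using minor_cocircuit_sig_eq[OF matroid_dual[OF M], of F G] FG dual_dual[OF M] by auto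
    moreover have "farkas (ground (minor M G F))
          (reorient A ` minor_circuit_sig M \<C> G F) (reorient A ` minor_cocircuit_sig M \<D> G F)"
      by (rule FP_oriented_farkas[OF assms]) (use FG A g in auto)
    ultimately show ?thesis unfolding g by (simp add: farkas_sym)
  qed
  then show ?thesis
    using C D by (auto simp: FP_oriented_def cocircuit_signature_def matroid_dual[OF M] dual_dual[OF M])
qed

text \<open>If two signings agree at \<open>e\<close> and differ at \<open>f\<close>, contract and delete down to the pair
  \<open>{e, f}\<close>, which is both a circuit and a cocircuit there. A signing of this cocircuit agrees, up to
  negation, with one of the two circuit signings, and reorienting along it violates the Farkas
  property.\<close>

lemma minor_circuit_sig_unique:
  assumes FP: "FP_oriented M \<C> \<D>" and F: "F \<subseteq> ground M"
    and X: "X \<in> minor_circuit_sig M \<C> F G" and Y: "Y \<in> minor_circuit_sig M \<C> F G"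
    and XY: "supp X = supp Y"
  shows "X = Y \<or> X = opposite Y"
proof (rule ccontr)
  assume no: "\<not> ?thesis"
  have M: "matroid M" and C: "circuit_signature M \<C>" and D: "circuit_signature (dual M) \<D>"
    using FP by (auto simp: FP_oriented_def cocircuit_signature_def)
  define D where "D = supp X"
  have cD: "circuit (minor M F G) D"
    using X by (auto simp: D_def minor_circuit_sig_iff)
  have dX: "pos X \<inter> neg X = {}" and dY: "pos Y \<inter> neg Y = {}"
    using minor_circuit_sig_disjoint[OF C] X Y by blast+
  have sX: "pos X \<union> neg X = D" and sY: "pos Y \<union> neg Y = D" using XY by (auto simp: D_def supp_def)
  have "\<exists>e\<in>D. e \<in> pos X \<longleftrightarrow> e \<in> pos Y"
  proof (rule ccontr)
    assume "\<not> ?thesis"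
    then have "pos X = neg Y" "neg X = pos Y" using dX dY sX sY by blast+
    then have "X = opposite Y" by (simp add: opposite_def signed.expand)
    with no show False by blast
  qed
  then obtain e where e: "e \<in> D" "e \<in> pos X \<longleftrightarrow> e \<in> pos Y" by blast
  have "\<exists>f\<in>D. f \<in> pos X \<longleftrightarrow> f \<notin> pos Y"
  proof (rule ccontr)
    assume "\<not> ?thesis"
    then have "pos X = pos Y" "neg X = neg Y" using dX dY sX sY e by blast+
    then have "X = Y" by (simp add: signed.expand)
    with no show False by blast
  qed
  then obtain f where f: "f \<in> D" "f \<in> pos X \<longleftrightarrow> f \<notin> pos Y" by blast
  have "e \<noteq> f" using e f by blast
  define F' G' where "F' = F \<union> (D - {e, f})" and "G' = ground M - F - D"
  let ?N = "minor M F' G'"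
  note pair = circuit_minor_pair[OF M F cD e(1) f(1) \<open>e \<noteq> f\<close>, folded F'_def G'_def]
  have DE: "D \<subseteq> ground M - (F \<union> G)" using cD by (auto simp: circuit_def ground_minor)
  have FG': "F' \<subseteq> ground M" "G' \<subseteq> ground M" "F' \<inter> G' = {}"
    using F DE by (auto simp: F'_def G'_def)
  have gN: "ground M - (F' \<union> G') = {e, f}" using pair(3) by (simp add: ground_minor)
  \<comment> \<open>The underlying signed circuit of \<open>M\<close> has support inside
    \<open>D \<union> F\<close>. Since \<open>F'\<close> takes in the rest of \<open>D\<close>, the
    same signed circuit is admissible for the smaller minor.\<close>
  have restr: "restrict_signed Z {e, f} \<in> minor_circuit_sig M \<C> F' G'"
    if Z: "Z \<in> minor_circuit_sig M \<C> F G" and sZ: "supp Z = D" for Z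
  proof -
    obtain W where W: "W \<in> \<C>" "Z = restrict_signed W (ground M - (F \<union> G))"
        "supp W \<subseteq> ground M - (F \<union> G) \<union> F"
      using Z unfolding minor_circuit_sig_iff by blast
    have sW: "supp W \<inter> (ground M - (F \<union> G)) = D" using W sZ by simp
    have "(ground M - (F \<union> G)) \<inter> {e, f} = {e, f}" using DE e f by blast
    then have "restrict_signed Z {e, f} = restrict_signed W {e, f}" using W by simp
    moreover have "supp W \<inter> {e, f} = {e, f}" using sW e f by blast
    moreover have "supp W \<subseteq> {e, f} \<union> F'" using W sW by (auto simp: F'_def)
    ultimately show ?thesis unfolding minor_circuit_sig_iff gN using W pair(1) by auto
  qed
  have "circuit (minor (dual M) G' F') {e, f}"
    using pair(2) dual_minor[OF M FG'(1,3)] by (simp add: cocircuit_def)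
  then obtain U0 where U0: "U0 \<in> minor_circuit_sig (dual M) \<D> G' F'" "supp U0 = {e, f}"
    using minor_circuit_sig_ex[OF matroid_dual[OF M] D, of G' F' "{e, f}"] FG' by auto
  obtain U where U: "U \<in> minor_circuit_sig (dual M) \<D> G' F'" "supp U = {e, f}"
    and Ue: "e \<in> pos U \<longleftrightarrow> e \<in> pos X"
  proof (cases "e \<in> pos U0 \<longleftrightarrow> e \<in> pos X")
    case True then show ?thesis using that U0 by blast
  next
    case False
    have "pos U0 \<inter> neg U0 = {}" using minor_circuit_sig_disjoint[OF D U0(1)] .
    then have "e \<in> neg U0 \<longleftrightarrow> e \<notin> pos U0" using U0(2) by (auto simp: supp_def)
    then show ?thesis
      using that[of "opposite U0"] U0 False minor_circuit_sig_opposite[OF D U0(1)]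
      by (simp add: opposite_def supp_def Un_commute)
  qed
  have dU: "pos U \<inter> neg U = {}" using minor_circuit_sig_disjoint[OF D U(1)] .
  have sU: "pos U \<union> neg U = {e, f}" using U(2) by (simp add: supp_def)
  have eqU: "U = restrict_signed Z {e, f}"
    if "pos Z \<inter> neg Z = {}" "pos Z \<union> neg Z = D" "e \<in> pos Z \<longleftrightarrow> e \<in> pos U" "f \<in> pos Z \<longleftrightarrow> f \<in> pos U"
    for Z
  proof (rule signed.expand, intro conjI)
    show p: "pos U = pos (restrict_signed Z {e, f})"
      using that sU by (auto simp: restrict_signed_def)
    have "neg U = {e, f} - pos U" using dU sU by blast
    moreover have "neg Z \<inter> {e, f} = {e, f} - pos Z" using that(1,2) e(1) f(1) by blast
    ultimately show "neg U = neg (restrict_signed Z {e, f})"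
      using p by (auto simp: restrict_signed_def)
  qed
  \<comment> \<open>With the sign at \<open>e\<close> fixed, only two signings of the pair remain,
    and \<open>X\<close> and \<open>Y\<close>, which differ at \<open>f\<close>, realise
    both.\<close>
  have "U = restrict_signed X {e, f} \<or> U = restrict_signed Y {e, f}"
    using eqU[OF dX sX] eqU[OF dY sY] Ue e f by blast
  then have UC: "U \<in> minor_circuit_sig M \<C> F' G'"
    using restr[OF X] restr[OF Y] XY by (auto simp: D_def)
  have UD: "U \<in> minor_cocircuit_sig M \<D> F' G'"
    using U minor_cocircuit_sig_eq[OF M FG'(1,3)] by simp
  have "neg U \<subseteq> ground ?N" using sU pair(3) by auto
  then have "farkas (ground ?N) (reorient (neg U) ` minor_circuit_sig M \<C> F' G')
      (reorient (neg U) ` minor_cocircuit_sig M \<D> F' G')"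
    by (rule FP_oriented_farkas[OF FP FG'])
  then show False using farkas_not_common[OF _ UC UD dU, of _ e] pair(3) U(2) by auto
qed

section \<open>Induced signatures of iterated minors\<close>

text \<open>Lifting circuits yields a signing of each circuit, and
  \<open>minor_circuit_sig_unique\<close> leaves only its opposite besides it. These two differ
  because circuits are nonempty.\<close>

lemma circuit_signature_minor:
  assumes FP: "FP_oriented M \<C> \<D>" and F: "F \<subseteq> ground M"
  shows "circuit_signature (minor M F G) (minor_circuit_sig M \<C> F G)"
proof -
  let ?S = "minor_circuit_sig M \<C> F G"
  have M: "matroid M" and C: "circuit_signature M \<C>"
    using FP by (auto simp: FP_oriented_def)
  have "signed_subset (ground (minor M F G)) X \<and> circuit (minor M F G) (supp X)" if "X \<in> ?S" for X
    using that minor_circuit_sig_disjoint[OF C that]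
    unfolding minor_circuit_sig_iff by (auto simp: signed_subset_def ground_minor)
  moreover have "\<exists>X. X \<noteq> opposite X \<and> {Y \<in> ?S. supp Y = D} = {X, opposite X}"
    if D: "circuit (minor M F G) D" for D
  proof -
    obtain X where X: "X \<in> ?S" "supp X = D" using minor_circuit_sig_ex[OF M C F D] .
    have "pos X \<union> neg X \<noteq> {}"
      using X circuit_nonempty[OF matroid_minor[OF M] D] by (simp add: supp_def)
    then have "pos X \<noteq> neg X" using minor_circuit_sig_disjoint[OF C X(1)] by blast
    then have "X \<noteq> opposite X" by (metis opposite_def signed.sel(1))
    moreover have "{Y \<in> ?S. supp Y = D} = {X, opposite X}"
      using minor_circuit_sig_unique[OF FP F _ X(1)] X minor_circuit_sig_opposite[OF C X(1)]
      by auto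
    ultimately show ?thesis by blast
  qed
  ultimately show ?thesis unfolding circuit_signature_def by blast
qed

text \<open>A circuit of \<open>M\<close> whose trace is a circuit of the smaller minor need not trace a circuit of the
  intermediate one; uniqueness of the signing allows it to be replaced by one that does.\<close>

lemma minor_circuit_sig_minor:
  assumes FP: "FP_oriented M \<C> \<D>" and F: "F \<subseteq> ground M"
    and F': "F' \<subseteq> ground (minor M F G)"
  shows "minor_circuit_sig (minor M F G) (minor_circuit_sig M \<C> F G) F' G'
    = minor_circuit_sig M \<C> (F \<union> F') (G \<union> G')" (is "?L = ?R")
proof -
  have M: "matroid M" and C: "circuit_signature M \<C>" using FP by (auto simp: FP_oriented_def)
  note N = circuit_signature_minor[OF FP F]
  have mm: "minor (minor M F G) F' G' = minor M (F \<union> F') (G \<union> G')"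
    using minor_minor[OF M, of F' F G G'] F' by (auto simp: ground_minor)
  have g: "ground (minor M F G) - (F' \<union> G') = ground M - (F \<union> F' \<union> (G \<union> G'))"
    by (auto simp: ground_minor)
  have FF: "F \<union> F' \<subseteq> ground M" using F F' by (auto simp: ground_minor)
  \<comment> \<open>Traces compose: the elements lost in the two stages lie in \<open>F\<close> and
    in \<open>F'\<close>, so the original circuit is admissible for
    \<open>F \<union> F'\<close>.\<close>
  have LR: "?L \<subseteq> ?R"
  proof
    fix Y assume "Y \<in> ?L"
    then obtain Z where Z: "Z \<in> minor_circuit_sig M \<C> F G"
        "Y = restrict_signed Z (ground M - (F \<union> F' \<union> (G \<union> G')))"
        "circuit (minor M (F \<union> F') (G \<union> G')) (supp Z \<inter> (ground M - (F \<union> F' \<union> (G \<union> G'))))"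
        "supp Z \<subseteq> ground M - (F \<union> F' \<union> (G \<union> G')) \<union> F'"
      unfolding minor_circuit_sig_iff[of _ "minor M F G"] mm g by blast
    obtain X where X: "X \<in> \<C>" "Z = restrict_signed X (ground M - (F \<union> G))"
        "supp X \<subseteq> ground M - (F \<union> G) \<union> F"
      using Z unfolding minor_circuit_sig_iff by blast
    have i: "(ground M - (F \<union> G)) \<inter> (ground M - (F \<union> F' \<union> (G \<union> G')))
        = ground M - (F \<union> F' \<union> (G \<union> G'))" by blast
    show "Y \<in> ?R"
      unfolding minor_circuit_sig_iff
      using X Z by (intro bexI[of _ X]) (auto simp: i Int_assoc)
  qed
  moreover have "?R \<subseteq> ?L"
  proof
    fix Y assume Y: "Y \<in> ?R"
    then have "circuit (minor (minor M F G) F' G') (supp Y)"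
      unfolding mm minor_circuit_sig_iff by auto
    \<comment> \<open>The replacement is found in \<open>?L\<close> by lifting from the iterated
      minor to the intermediate one. \<open>LR\<close> places it in \<open>?R\<close>, where
      uniqueness over \<open>M\<close> compares it with \<open>Y\<close>.\<close>
    then obtain Z where Z: "Z \<in> ?L" "supp Z = supp Y"
      using minor_circuit_sig_ex[OF matroid_minor[OF M] N F'] by blast
    then have "Y = Z \<or> Y = opposite Z"
      using minor_circuit_sig_unique[OF FP FF Y] LR by auto
    then show "Y \<in> ?L" using Z minor_circuit_sig_opposite[OF N Z(1)] by blast
  qed
  ultimately show ?thesis by blast
qed

lemma FP_oriented_minor:
  assumes FP: "FP_oriented M \<C> \<D>"
    and F: "F \<subseteq> ground M" and G: "G \<subseteq> ground M" and FG: "F \<inter> G = {}"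
  shows "FP_oriented (minor M F G) (minor_circuit_sig M \<C> F G) (minor_cocircuit_sig M \<D> F G)"
proof -
  have M: "matroid M" using FP by (simp add: FP_oriented_def)
  note FPd = FP_oriented_dual[OF FP]
  have GE: "G \<subseteq> ground (dual M)" using G by auto
  note dm = dual_minor[OF M F FG] and cs = minor_cocircuit_sig_eq[OF M F FG]
  have "farkas (ground (minor (minor M F G) F' G'))
          (reorient A ` minor_circuit_sig (minor M F G) (minor_circuit_sig M \<C> F G) F' G')
          (reorient A ` minor_cocircuit_sig (minor M F G) (minor_cocircuit_sig M \<D> F G) F' G')"
    if F': "F' \<subseteq> ground (minor M F G)" and G': "G' \<subseteq> ground (minor M F G)" and FG': "F' \<inter> G' = {}"
      and A: "A \<subseteq> ground (minor (minor M F G) F' G')" for F' G' A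
  proof -
    have mm: "minor (minor M F G) F' G' = minor M (F \<union> F') (G \<union> G')"
      using minor_minor[OF M, of F' F G G'] F' by (auto simp: ground_minor)
    have FF: "F \<union> F' \<subseteq> ground M" "G \<union> G' \<subseteq> ground M" "(F \<union> F') \<inter> (G \<union> G') = {}"
      using F G F' FG G' FG' by (auto simp: ground_minor)
    \<comment> \<open>The cocircuit side is carried to the dual, where the identity for circuits of
      iterated minors applies, and then carried back.\<close>
    have "minor_cocircuit_sig (minor M F G) (minor_cocircuit_sig M \<D> F G) F' G'
        = minor_circuit_sig (minor (dual M) G F) (minor_circuit_sig (dual M) \<D> G F) G' F'"
      using minor_cocircuit_sig_eq[OF matroid_minor[OF M] F' FG'] by (simp add: dm cs)
    also have "\<dots> = minor_circuit_sig (dual M) \<D> (G \<union> G') (F \<union> F')"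
      using G' by (intro minor_circuit_sig_minor[OF FPd GE]) (auto simp: ground_minor)
    also have "\<dots> = minor_cocircuit_sig M \<D> (F \<union> F') (G \<union> G')"
      using minor_cocircuit_sig_eq[OF M FF(1,3)] by simp
    finally show ?thesis
      using FP_oriented_farkas[OF FP FF] A
      unfolding mm minor_circuit_sig_minor[OF FP F F'] by simp
  qed
  moreover have "cocircuit_signature (minor M F G) (minor_cocircuit_sig M \<D> F G)"
    unfolding cocircuit_signature_def dm cs by (rule circuit_signature_minor[OF FPd GE])
  ultimately show ?thesis
    using matroid_minor[OF M] circuit_signature_minor[OF FP F] by (simp add: FP_oriented_def)
qed

theorem theorem5p21:
  fixes M :: "'a set_system" and \<C> \<D> :: "'a signed set" and F G :: "'a set"
  assumes "FP_oriented M \<C> \<D>"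
    and "F \<subseteq> ground M" and "G \<subseteq> ground M" and "F \<inter> G = {}"
  shows "FP_oriented (minor M F G) (minor_circuit_sig M \<C> F G) (minor_cocircuit_sig M \<D> F G)
    \<and> minor_closed (FP_oriented :: 'a set_system \<Rightarrow> 'a signed set \<Rightarrow> 'a signed set \<Rightarrow> bool)"
  using FP_oriented_minor assms unfolding minor_closed_def by blast

end
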